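(* Every strong semicomplete composition $Q=T[H_1,\dots,H_t]$ with at least four vertices has two distinct vertices $v_1,v_2$ such that $Q-v_i$ is strong for each $i\in\{1,2\}$.
   Context: Digraphs are finite, without loops or parallel arcs (2-cycles are allowed). A digraph is semicomplete if there is at least one arc between every pair of distinct vertices. Let $T$ be a digraph with vertices $u_1,\dots,u_t$ ($t\ge 2$) and let $H_1,\dots,H_t$ be pairwise disjoint nonempty digraphs, where $H_i$ has $n_i$ vertices. The composition $Q=T[H_1,\dots,H_t]$ is the digraph with vertex set $\bigcup_i V(H_i)$ and arc set $\bigcup_{i=1}^t A(H_i)\cup\{xy : x\in V(H_i),\ y\in V(H_p),\ u_iu_p\in A(T)\}$. It is a semicomplete composition if $T$ is semicomplete. A digraph is strong if for every ordered pair of vertices $(x,y)$ there is a directed path from $x$ to $y$. *)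

theory Defs
  imports "Graph_Theory.Graph_Theory" "HOL-Library.Disjoint_Sets"
begin

definition semicomplete :: "('a, 'b) pre_digraph \<Rightarrow> bool" where
  "semicomplete G \<longleftrightarrow>
    (\<forall>u\<in>verts G. \<forall>v\<in>verts G. u \<noteq> v \<longrightarrow> u \<rightarrow>\<^bsub>G\<^esub> v \<or> v \<rightarrow>\<^bsub>G\<^esub> u)"

text \<open>
  The digraph that is substituted for a vertex \<open>u\<close> of \<open>T\<close> is \<open>H u\<close>: the factors are indexed by the
  vertices of \<open>T\<close> themselves rather than by an enumeration \<open>1, \<dots>, t\<close> of them.
\<close>
definition composition ::
    "'t pair_pre_digraph \<Rightarrow> ('t \<Rightarrow> 'a pair_pre_digraph) \<Rightarrow> 'a pair_pre_digraph" where
  "composition T H =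
    \<lparr> pverts = (\<Union>u\<in>pverts T. pverts (H u)),
      parcs = (\<Union>u\<in>pverts T. parcs (H u)) \<union>
              {(x, y). \<exists>u w. (u, w) \<in> parcs T \<and> x \<in> pverts (H u) \<and> y \<in> pverts (H w)} \<rparr>"

lemma pair_digraph_composition:
  assumes "pair_digraph T"
    and H: "\<And>u. u \<in> pverts T \<Longrightarrow> pair_digraph (H u)"
    and disj: "disjoint_family_on (\<lambda>u. pverts (H u)) (pverts T)"
  shows "pair_digraph (composition T H)"
proof -
  interpret T: pair_digraph T by fact
  let ?Q = "composition T H"
  have fin: "finite (pverts ?Q)"
    using H by (auto simp: composition_def pair_digraph_def pair_fin_digraph_def
        pair_fin_digraph_axioms_def)
  have sub: "x \<in> pverts ?Q \<and> y \<in> pverts ?Q \<and> x \<noteq> y" if xy: "(x, y) \<in> parcs ?Q" for x y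
  proof -
    consider u where "u \<in> pverts T" "(x, y) \<in> parcs (H u)"
      | u w where "(u, w) \<in> parcs T" "x \<in> pverts (H u)" "y \<in> pverts (H w)"
      using xy by (auto simp: composition_def)
    then show ?thesis
    proof cases
      case 1
      interpret Hu: pair_digraph "H u" by (rule H) fact
      have "x \<in> pverts (H u)" "y \<in> pverts (H u)" "x \<noteq> y"
        using 1(2) Hu.wellformed' Hu.no_loops' by blast+
      then show ?thesis using 1(1) by (auto simp: composition_def)
    next
      case 2
      then have "u \<in> pverts T" "w \<in> pverts T" "u \<noteq> w"
        using T.wellformed' T.no_loops' by blast+
      then show ?thesis using 2 disj by (auto simp: composition_def disjoint_family_on_def)
    qed
  qed
  have "parcs ?Q \<subseteq> pverts ?Q \<times> pverts ?Q" using sub by auto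
  then have "finite (parcs ?Q)" using fin by (blast intro: finite_subset)
  with fin sub show ?thesis by unfold_locales force+
qed

end

theory Submission
  imports Defs
begin

text \<open>
  If some factor has two vertices, each of them can be deleted: every remaining vertex set that
  meets all factors induces a strong digraph because \<open>T\<close> is strong. Otherwise \<open>Q\<close> is itself
  semicomplete, and it suffices to find, for every vertex \<open>v\<close>, a deletable vertex \<open>w \<noteq> v\<close>; applying
  this twice gives two distinct ones. Let \<open>S\<close> be a maximal proper vertex set that contains \<open>v\<close> and
  induces a strong digraph. If \<open>S\<close> misses more than one vertex, then by maximality every vertex
  outside \<open>S\<close> either dominates all of \<open>S\<close> or is dominated by all of \<open>S\<close>, without arcs in the other
  direction. An arc \<open>b \<rightarrow> a\<close> from a vertex dominated by \<open>S\<close> to one dominating \<open>S\<close> closes the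
  triangles \<open>x \<rightarrow> b \<rightarrow> a \<rightarrow> x\<close> for \<open>x \<in> S\<close>. So \<open>S \<union> {a, b}\<close> induces a strong digraph and contains all
  vertices, and any vertex of \<open>S\<close> other than \<open>v\<close> can be deleted.
\<close>

unbundle no funcset_syntax

section \<open>Strong induced subdigraphs\<close>

lemma dominates_induce_subgraph_iff [simp]:
  "u \<rightarrow>\<^bsub>G \<restriction> S\<^esub> v \<longleftrightarrow> u \<rightarrow>\<^bsub>G\<^esub> v \<and> u \<in> S \<and> v \<in> S"
  by (auto simp: arcs_ends_conv)

context wf_digraph
begin

lemma del_vert_eq_induce_subgraph: "del_vert v = G \<restriction> (verts G - {v})"
  by (auto simp: del_vert_def induce_subgraph_def)

lemma strongly_connectedI_hub:
  assumes "h \<in> verts G"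
    and to_hub: "\<And>u. u \<in> verts G \<Longrightarrow> u \<rightarrow>\<^sup>* h"
    and from_hub: "\<And>u. u \<in> verts G \<Longrightarrow> h \<rightarrow>\<^sup>* u"
  shows "strongly_connected G"
proof
  show "verts G \<noteq> {}" using \<open>h \<in> verts G\<close> by blast
  show "u \<rightarrow>\<^sup>* v" if "u \<in> verts G" "v \<in> verts G" for u v
    using to_hub[OF that(1)] from_hub[OF that(2)] by (rule reachable_trans)
qed

lemma strongly_connected_reachable1:
  assumes "strongly_connected G" and "\<not> is_singleton (verts G)"
    and u: "u \<in> verts G" and v: "v \<in> verts G"
  shows "u \<rightarrow>\<^sup>+ v"
proof -
  obtain w where w: "w \<in> verts G" "w \<noteq> u"
    using assms(2) u by (auto simp: is_singleton_def)
  then have "u \<rightarrow>\<^sup>+ w" using assms(1) u by blast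
  also have "w \<rightarrow>\<^sup>* v" using assms(1) w v by blast
  finally show ?thesis .
qed

lemma reachable_leavesE:
  assumes "u \<rightarrow>\<^sup>* v" and "u \<in> X" and "v \<notin> X"
  obtains a b where "a \<in> X" "b \<notin> X" "a \<rightarrow> b"
proof -
  have "v \<in> X \<or> (\<exists>a\<in>X. \<exists>b. b \<notin> X \<and> a \<rightarrow> b)"
    using assms(1,2) by (induct rule: reachable_induct) blast+
  then show thesis using \<open>v \<notin> X\<close> that by blast
qed

lemma strongly_connected_induce_insert:
  assumes strong: "strongly_connected (G \<restriction> S)"
    and s: "s \<in> S" "s \<rightarrow> w" and t: "t \<in> S" "w \<rightarrow> t"
  shows "strongly_connected (G \<restriction> insert w S)"
proof -
  interpret D: wf_digraph "G \<restriction> insert w S" ..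
  have within: "x \<rightarrow>\<^sup>*\<^bsub>G \<restriction> insert w S\<^esub> y" if "x \<in> S" "y \<in> S" for x y
  proof -
    have "x \<rightarrow>\<^sup>*\<^bsub>G \<restriction> S\<^esub> y" using strong that by (simp add: strongly_connected_def)
    then show ?thesis by (rule reachable_induce_ss) blast
  qed
  have sw: "s \<rightarrow>\<^bsub>G \<restriction> insert w S\<^esub> w" and wt: "w \<rightarrow>\<^bsub>G \<restriction> insert w S\<^esub> t"
    using s t by auto
  have to_w: "x \<rightarrow>\<^sup>*\<^bsub>G \<restriction> insert w S\<^esub> w" if "x \<in> S" for x
    using within[OF that s(1)] sw by (rule D.reachable_adj_trans)
  have from_w: "w \<rightarrow>\<^sup>*\<^bsub>G \<restriction> insert w S\<^esub> x" if "x \<in> S" for x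
    using wt within[OF t(1) that] by (rule D.adj_reachable_trans)
  show ?thesis
    by (rule D.strongly_connectedI_hub[where h = w]) (use to_w from_w in auto)
qed

lemma strongly_connected_induce_triangles:
  assumes "X \<noteq> {}" and ba: "b \<rightarrow> a"
    and ax: "\<And>x. x \<in> X \<Longrightarrow> a \<rightarrow> x" and xb: "\<And>x. x \<in> X \<Longrightarrow> x \<rightarrow> b"
  shows "strongly_connected (G \<restriction> insert a (insert b X))" (is "strongly_connected ?D")
proof -
  interpret D: wf_digraph ?D ..
  obtain x where x: "x \<in> X" using \<open>X \<noteq> {}\<close> by blast
  have closing_arc: "b \<rightarrow>\<^bsub>?D\<^esub> a" using ba by simp
  have spokes: "a \<rightarrow>\<^bsub>?D\<^esub> y" "y \<rightarrow>\<^bsub>?D\<^esub> b" if "y \<in> X" for y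
    using ax xb that by auto
  have reach: "y \<rightarrow>\<^sup>*\<^bsub>?D\<^esub> a \<and> a \<rightarrow>\<^sup>*\<^bsub>?D\<^esub> y" if "y \<in> verts ?D" for y
  proof -
    consider "y = a" | "y = b" | "y \<in> X" using \<open>y \<in> verts ?D\<close> by auto
    then show ?thesis
    proof cases
      case 1
      then show ?thesis by simp
    next
      case 2
      have "a \<rightarrow>\<^bsub>?D\<^esub> x" using x by (rule spokes)
      also have "x \<rightarrow>\<^sup>*\<^bsub>?D\<^esub> b" using spokes(2)[OF x] by (rule D.reachable_adjI)
      finally show ?thesis using 2 closing_arc by blast
    next
      case 3
      then have "y \<rightarrow>\<^bsub>?D\<^esub> b" by (rule spokes)
      also have "b \<rightarrow>\<^sup>*\<^bsub>?D\<^esub> a" using closing_arc by (rule D.reachable_adjI)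
      finally show ?thesis using spokes(1)[OF 3] by blast
    qed
  qed
  show ?thesis
    by (rule D.strongly_connectedI_hub[where h = a]) (use reach in auto)
qed

end

section \<open>Semicomplete digraphs\<close>

definition (in pre_digraph) max_proper_strong :: "'a set \<Rightarrow> bool" where
  "max_proper_strong S \<longleftrightarrow> S \<subset> verts G \<and> strongly_connected (G \<restriction> S) \<and>
    (\<forall>S'. S \<subset> S' \<and> S' \<subset> verts G \<longrightarrow> \<not> strongly_connected (G \<restriction> S'))"

lemma (in wf_digraph) ex_max_proper_strong:
  assumes "finite (verts G)" and "\<not> is_singleton (verts G)" and "v \<in> verts G"
  shows "\<exists>S. max_proper_strong S \<and> v \<in> S"
proof -
  define F where "F = {S. v \<in> S \<and> S \<subset> verts G \<and> strongly_connected (G \<restriction> S)}"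
  have "strongly_connected (G \<restriction> {v})"
    by (simp add: strongly_connected_def reachable_def)
  moreover have "{v} \<subset> verts G" using assms(2,3) by (auto simp: is_singleton_def)
  ultimately have "{v} \<in> F" by (simp add: F_def)
  moreover have "finite F"
    by (rule finite_subset[of _ "Pow (verts G)"]) (use assms(1) in \<open>auto simp: F_def\<close>)
  ultimately obtain S where "S \<in> F" "\<forall>S'\<in>F. S \<subseteq> S' \<longrightarrow> S = S'"
    using finite_has_maximal[of F] by blast
  then show ?thesis unfolding F_def max_proper_strong_def by blast
qed

locale semicomplete_digraph = wf_digraph +
  assumes semicomplete: "semicomplete G"
begin

lemma strong_subset_dichotomy:
  assumes S: "S \<subseteq> verts G" "strongly_connected (G \<restriction> S)"
    and w: "w \<in> verts G - S" "\<not> strongly_connected (G \<restriction> insert w S)"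
  shows "(\<forall>s\<in>S. s \<rightarrow> w \<and> \<not> w \<rightarrow> s) \<or> (\<forall>s\<in>S. w \<rightarrow> s \<and> \<not> s \<rightarrow> w)"
proof -
  have "\<not> s \<rightarrow> w \<or> \<not> w \<rightarrow> t" if "s \<in> S" "t \<in> S" for s t
    using strongly_connected_induce_insert[OF S(2)] w(2) that by blast
  moreover have "s \<rightarrow> w \<or> w \<rightarrow> s" if "s \<in> S" for s
    using semicomplete that w(1) S(1) unfolding semicomplete_def by (metis DiffE subsetD)
  ultimately show ?thesis by blast
qed

lemma max_proper_strong_dichotomy:
  assumes S: "max_proper_strong S" and w: "w \<in> verts G - S" "insert w S \<noteq> verts G"
  shows "(\<forall>s\<in>S. s \<rightarrow> w \<and> \<not> w \<rightarrow> s) \<or> (\<forall>s\<in>S. w \<rightarrow> s \<and> \<not> s \<rightarrow> w)"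
proof (rule strong_subset_dichotomy)
  show "S \<subseteq> verts G" "strongly_connected (G \<restriction> S)"
    using S by (auto simp: max_proper_strong_def)
  have "S \<subset> insert w S" "insert w S \<subset> verts G"
    using \<open>S \<subseteq> verts G\<close> w by auto
  then show "\<not> strongly_connected (G \<restriction> insert w S)"
    using S unfolding max_proper_strong_def by blast
qed (fact w(1))

lemma max_proper_strong_triangles:
  assumes strong: "strongly_connected G" and S: "max_proper_strong S"
    and large: "\<And>w. insert w S \<noteq> verts G"
  obtains a b where "b \<rightarrow> a" "\<And>s. s \<in> S \<Longrightarrow> a \<rightarrow> s" "\<And>s. s \<in> S \<Longrightarrow> s \<rightarrow> b"
    "a \<notin> S" "b \<notin> S" "verts G = insert a (insert b S)"
proof -
  define B where "B = {w \<in> verts G - S. \<forall>s\<in>S. s \<rightarrow> w \<and> \<not> w \<rightarrow> s}"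
  note dichotomy = max_proper_strong_dichotomy[OF S _ large]
  have sub: "S \<subset> verts G" and strong_S: "strongly_connected (G \<restriction> S)"
    using S by (auto simp: max_proper_strong_def)
  obtain s where s: "s \<in> S" using strong_S by (auto simp: strongly_connected_def)
  obtain z where z: "z \<in> verts G - S" using sub by blast
  then have "s \<rightarrow>\<^sup>* z" using strong s sub by blast
  then obtain s0 b0 where "s0 \<in> S" "b0 \<notin> S" "s0 \<rightarrow> b0"
    using s z by (auto elim: reachable_leavesE)
  then have b0: "b0 \<in> B" using dichotomy[of b0] adj_in_verts unfolding B_def by blast
  then have "b0 \<rightarrow>\<^sup>* s" using strong s sub unfolding B_def by blast
  moreover have "s \<notin> B" using s by (simp add: B_def)
  ultimately obtain b a where b: "b \<in> B" and a: "a \<notin> B" and ba: "b \<rightarrow> a"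
    using b0 by (auto elim: reachable_leavesE)
  have "a \<in> verts G - S" using b ba adj_in_verts unfolding B_def by blast
  then have dom: "a \<rightarrow> s" "s \<rightarrow> b" if "s \<in> S" for s
    using dichotomy[of a] a b that unfolding B_def by blast+
  have "strongly_connected (G \<restriction> insert a (insert b S))"
    using s ba dom by (intro strongly_connected_induce_triangles) auto
  moreover have "S \<subset> insert a (insert b S)" "insert a (insert b S) \<subseteq> verts G"
    using \<open>a \<in> verts G - S\<close> b sub unfolding B_def by auto
  ultimately have "verts G = insert a (insert b S)"
    using S unfolding max_proper_strong_def by blast
  then show thesis using that[OF ba] dom \<open>a \<in> verts G - S\<close> b unfolding B_def by blast
qed

lemma ex_del_vert_strongly_connected_avoiding:
  assumes "strongly_connected G" and card: "card (verts G) \<ge> 4" and v: "v \<in> verts G"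
  shows "\<exists>w\<in>verts G - {v}. strongly_connected (del_vert w)"
proof -
  have "finite (verts G)" using card by (intro card_ge_0_finite) simp
  moreover have "\<not> is_singleton (verts G)" using card by (simp add: is_singleton_altdef)
  ultimately obtain S where S: "max_proper_strong S" "v \<in> S"
    using ex_max_proper_strong v by blast
  show ?thesis
  proof (cases "\<exists>w. insert w S = verts G")
    case True
    then obtain w where w: "insert w S = verts G" ..
    moreover have "w \<notin> S" using S w by (auto simp: max_proper_strong_def)
    ultimately have "verts G - {w} = S" "w \<in> verts G - {v}" using S(2) by auto
    then show ?thesis
      using S(1) by (auto simp: max_proper_strong_def del_vert_eq_induce_subgraph)
  next
    case False
    then obtain a b where ba: "b \<rightarrow> a"
      and dom: "\<And>s. s \<in> S \<Longrightarrow> a \<rightarrow> s" "\<And>s. s \<in> S \<Longrightarrow> s \<rightarrow> b"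
      and notin: "a \<notin> S" "b \<notin> S" and verts: "verts G = insert a (insert b S)"
      using max_proper_strong_triangles[OF assms(1) S(1)] by metis
    have "card {a, b, v} \<le> 3" by (simp add: card_insert_if)
    then have "S \<noteq> {v}" using card verts by auto
    then obtain s where s: "s \<in> S" "s \<noteq> v" using S(2) by blast
    have "strongly_connected (G \<restriction> insert a (insert b (S - {s})))"
      using s S(2) ba dom by (intro strongly_connected_induce_triangles) auto
    moreover have "insert a (insert b (S - {s})) = verts G - {s}"
      using verts notin s(1) by auto
    ultimately show ?thesis using s verts by (auto simp: del_vert_eq_induce_subgraph)
  qed
qed

theorem ex_two_del_vert_strongly_connected:
  assumes "strongly_connected G" and "card (verts G) \<ge> 4"
  shows "\<exists>v\<in>verts G. \<exists>w\<in>verts G. v \<noteq> w \<and>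
    strongly_connected (del_vert v) \<and> strongly_connected (del_vert w)"
proof -
  obtain u where "u \<in> verts G" using assms(1) by (auto simp: strongly_connected_def)
  then obtain v where v: "v \<in> verts G" "strongly_connected (del_vert v)"
    using ex_del_vert_strongly_connected_avoiding[OF assms] by blast
  then show ?thesis using ex_del_vert_strongly_connected_avoiding[OF assms v(1)] by blast
qed

end

section \<open>Compositions\<close>

lemma pverts_composition [simp]: "pverts (composition T H) = (\<Union>u\<in>pverts T. pverts (H u))"
  by (simp add: composition_def)

lemma parcs_compositionI:
  assumes "(u, w) \<in> parcs T" "x \<in> pverts (H u)" "y \<in> pverts (H w)"
  shows "(x, y) \<in> parcs (composition T H)"
  using assms by (auto simp: composition_def)

lemma parcs_compositionE:
  assumes "(x, y) \<in> parcs (composition T H)"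
  obtains (factor) u where "u \<in> pverts T" "(x, y) \<in> parcs (H u)"
    | (cross) u w where "(u, w) \<in> parcs T" "x \<in> pverts (H u)" "y \<in> pverts (H w)"
  using assms by (auto simp: composition_def)

lemma semicomplete_composition:
  assumes "semicomplete (with_proj T)"
    and singleton: "\<And>u x y. u \<in> pverts T \<Longrightarrow> x \<in> pverts (H u) \<Longrightarrow> y \<in> pverts (H u) \<Longrightarrow> x = y"
  shows "semicomplete (with_proj (composition T H))"
  unfolding semicomplete_def
proof (intro ballI impI)
  fix x y
  assume "x \<in> verts (composition T H)" "y \<in> verts (composition T H)" "x \<noteq> y"
  then obtain u w where uw: "u \<in> pverts T" "x \<in> pverts (H u)" "w \<in> pverts T" "y \<in> pverts (H w)"
    by auto
  then have "u \<noteq> w" using singleton \<open>x \<noteq> y\<close> by blast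
  then have "(u, w) \<in> parcs T \<or> (w, u) \<in> parcs T"
    using assms(1) uw by (auto simp: semicomplete_def)
  then show "x \<rightarrow>\<^bsub>composition T H\<^esub> y \<or> y \<rightarrow>\<^bsub>composition T H\<^esub> x"
    using uw by (auto intro: parcs_compositionI)
qed

locale wf_composition = T: pair_wf_digraph T
  for T :: "'t pair_pre_digraph" and H :: "'t \<Rightarrow> 'a pair_pre_digraph" +
  assumes wf_factor: "u \<in> pverts T \<Longrightarrow> pair_wf_digraph (H u)"
    and factor_nonempty: "u \<in> pverts T \<Longrightarrow> pverts (H u) \<noteq> {}"
    and factors_disjoint: "disjoint_family_on (\<lambda>u. pverts (H u)) (pverts T)"
begin

abbreviation Q :: "'a pair_pre_digraph" where
  "Q \<equiv> composition T H"

sublocale Q: pair_wf_digraph Q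
proof -
  have "x \<in> pverts Q \<and> y \<in> pverts Q" if "(x, y) \<in> parcs Q" for x y
    using that
  proof (cases rule: parcs_compositionE)
    case (factor u)
    then have "x \<in> pverts (H u)" "y \<in> pverts (H u)"
      using pair_wf_digraph.wellformed'[OF wf_factor] by blast+
    then show ?thesis using factor(1) by auto
  next
    case (cross u w)
    then show ?thesis using T.wellformed' by auto
  qed
  then show "pair_wf_digraph Q" by unfold_locales auto
qed

lemma factor_unique:
  assumes "u \<in> pverts T" "w \<in> pverts T" "x \<in> pverts (H u)" "x \<in> pverts (H w)"
  shows "u = w"
  using assms factors_disjoint by (auto simp: disjoint_family_on_def)

lemma reachable_if_reachable_composition:
  assumes "x \<rightarrow>\<^sup>*\<^bsub>Q\<^esub> y" and u: "u \<in> pverts T" "x \<in> pverts (H u)"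
    and "w \<in> pverts T" "y \<in> pverts (H w)"
  shows "u \<rightarrow>\<^sup>*\<^bsub>T\<^esub> w"
  using assms(1,4,5)
proof (induct arbitrary: w rule: Q.reachable_induct)
  case base
  then show ?case using factor_unique u by blast
next
  case (step y z)
  from step(2) have "(y, z) \<in> parcs Q" by simp
  then show ?case
  proof (cases rule: parcs_compositionE)
    case (factor p)
    then have "y \<in> pverts (H p)" "z \<in> pverts (H p)"
      using pair_wf_digraph.wellformed'[OF wf_factor] by blast+
    then show ?thesis using step factor_unique factor(1) by blast
  next
    case (cross p q)
    then have "u \<rightarrow>\<^sup>*\<^bsub>T\<^esub> p" using step T.wellformed' by blast
    also have "(p, q) \<in> parcs T" by (rule cross(1))
    also have "q = w" using cross step factor_unique T.wellformed' by blast
    finally show ?thesis .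
  qed
qed

lemma strongly_connected_if_composition:
  assumes "strongly_connected (with_proj Q)"
  shows "strongly_connected (with_proj T)"
proof
  show "verts T \<noteq> {}" using assms by (auto simp: strongly_connected_def)
  fix u w assume "u \<in> verts T" "w \<in> verts T"
  then have uw: "u \<in> pverts T" "w \<in> pverts T" by simp_all
  then obtain x y where xy: "x \<in> pverts (H u)" "y \<in> pverts (H w)"
    using factor_nonempty by blast
  then have "x \<rightarrow>\<^sup>*\<^bsub>Q\<^esub> y" using assms uw by (auto simp: strongly_connected_def)
  then show "u \<rightarrow>\<^sup>*\<^bsub>T\<^esub> w" using reachable_if_reachable_composition uw xy by blast
qed

lemma reachable1_induce_composition:
  assumes "u \<rightarrow>\<^sup>+\<^bsub>T\<^esub> w" and x: "x \<in> pverts (H u) \<inter> W" and "y \<in> pverts (H w) \<inter> W"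
    and transversal: "\<And>p. p \<in> pverts T \<Longrightarrow> pverts (H p) \<inter> W \<noteq> {}"
  shows "x \<rightarrow>\<^sup>+\<^bsub>with_proj Q \<restriction> W\<^esub> y"
  using assms(1,3)
proof (induct arbitrary: y)
  case (base w)
  then have "x \<rightarrow>\<^bsub>with_proj Q \<restriction> W\<^esub> y" using x by (auto intro: parcs_compositionI)
  then show ?case by (rule r_into_trancl')
next
  case (step p q)
  then obtain z where z: "z \<in> pverts (H p) \<inter> W"
    using transversal T.wellformed' by fastforce
  then have "x \<rightarrow>\<^sup>+\<^bsub>with_proj Q \<restriction> W\<^esub> z" by (rule step.hyps)
  moreover have "z \<rightarrow>\<^bsub>with_proj Q \<restriction> W\<^esub> y"
    using z step by (auto intro: parcs_compositionI)
  ultimately show ?case by (rule trancl_into_trancl)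
qed

lemma strongly_connected_induce_composition:
  assumes T: "strongly_connected (with_proj T)" "\<not> is_singleton (pverts T)"
    and W: "W \<subseteq> pverts Q" and transversal: "\<And>p. p \<in> pverts T \<Longrightarrow> pverts (H p) \<inter> W \<noteq> {}"
  shows "strongly_connected (with_proj Q \<restriction> W)"
proof
  show "verts (with_proj Q \<restriction> W) \<noteq> {}"
    using T(1) transversal by (auto simp: strongly_connected_def)
  fix x y assume "x \<in> verts (with_proj Q \<restriction> W)" "y \<in> verts (with_proj Q \<restriction> W)"
  then obtain u w where uw: "u \<in> pverts T" "x \<in> pverts (H u) \<inter> W"
      "w \<in> pverts T" "y \<in> pverts (H w) \<inter> W"
    using W by simp blast
  then have "u \<rightarrow>\<^sup>+\<^bsub>T\<^esub> w" using T.strongly_connected_reachable1 T by simp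
  then have "x \<rightarrow>\<^sup>+\<^bsub>with_proj Q \<restriction> W\<^esub> y"
    using reachable1_induce_composition transversal uw by blast
  then show "x \<rightarrow>\<^sup>*\<^bsub>with_proj Q \<restriction> W\<^esub> y"
    by (rule wf_digraph.reachable1_reachable[OF Q.wellformed_induce_subgraph])
qed

lemma strongly_connected_del_vert_composition:
  assumes "strongly_connected (with_proj Q)" and "\<not> is_singleton (pverts T)"
    and u: "u \<in> pverts T" and xy: "x \<in> pverts (H u)" "y \<in> pverts (H u)" "x \<noteq> y"
  shows "strongly_connected (Q.del_vert x)"
proof -
  have "pverts (H p) \<inter> (pverts Q - {x}) \<noteq> {}" if p: "p \<in> pverts T" for p
  proof (cases "p = u")
    case True
    then show ?thesis using xy u by auto
  next
    case False
    then have "x \<notin> pverts (H p)" using factor_unique p u xy(1) by blast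
    then show ?thesis using factor_nonempty[OF p] p by auto
  qed
  then show ?thesis
    using strongly_connected_induce_composition[OF strongly_connected_if_composition] assms(1,2)
    by (simp add: Q.del_vert_eq_induce_subgraph)
qed

end

theorem theorem2p5:
  fixes T :: "'t pair_pre_digraph" and H :: "'t \<Rightarrow> 'a pair_pre_digraph"
    and Q :: "'a pair_pre_digraph"
  assumes "pair_digraph T" and "card (pverts T) \<ge> 2"
    and "\<And>u. u \<in> pverts T \<Longrightarrow> pair_digraph (H u)"
    and "\<And>u. u \<in> pverts T \<Longrightarrow> pverts (H u) \<noteq> {}"
    and "disjoint_family_on (\<lambda>u. pverts (H u)) (pverts T)"
    and "Q = composition T H"
    and "semicomplete (with_proj T)"
    and "strongly_connected (with_proj Q)"
    and "card (pverts Q) \<ge> 4"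
  shows "\<exists>v1\<in>pverts Q. \<exists>v2\<in>pverts Q. v1 \<noteq> v2 \<and>
           strongly_connected (pre_digraph.del_vert (with_proj Q) v1) \<and>
           strongly_connected (pre_digraph.del_vert (with_proj Q) v2)"
proof -
  interpret wf_composition T H
    by (intro wf_composition.intro wf_composition_axioms.intro
        pair_digraph.pair_wf_digraph assms(1,3-5))
  have nontrivial: "\<not> is_singleton (pverts T)"
    using assms(2) by (simp add: is_singleton_altdef)
  have strong: "strongly_connected (with_proj (composition T H))"
    using assms(6,8) by simp
  show ?thesis
  proof (cases "\<exists>u\<in>pverts T. \<exists>x\<in>pverts (H u). \<exists>y\<in>pverts (H u). x \<noteq> y")
    case True
    then obtain u x y where u: "u \<in> pverts T" "x \<in> pverts (H u)" "y \<in> pverts (H u)" "x \<noteq> y"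
      by blast
    then have "strongly_connected (Q.del_vert x)" "strongly_connected (Q.del_vert y)"
      using strongly_connected_del_vert_composition[OF strong nontrivial u(1)] by metis+
    then show ?thesis using u assms(6) by auto
  next
    case False
    then have "semicomplete (with_proj (composition T H))"
      using assms(7) by (intro semicomplete_composition) blast+
    then interpret semicomplete_digraph "with_proj (composition T H)"
      by unfold_locales
    show ?thesis
      using ex_two_del_vert_strongly_connected strong assms(6,9) by simp
  qed
qed

end
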